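(* Let $n,N_1,N_2,N_3\ge1$. Consider the Gaussian model of a complex 3-index tensor $\Phi^{i_1i_2i_3}$, $i_a\in\{1,\dots,N_a\}$, with two-point function $\langle\Phi^{i_1i_2i_3}\bar\Phi^{j_1j_2j_3}\rangle=\delta^{i_1j_1}\delta^{i_2j_2}\delta^{i_3j_3}$. For all $\sigma_1,\sigma_2,\sigma_3,\tau_1,\tau_2,\tau_3\in S_n$, the normal-ordered two-point function of the observables $\mathcal O_{\sigma_1,\sigma_2,\sigma_3}$ and $\bar{\mathcal O}_{\tau_1,\tau_2,\tau_3}=\mathcal O_{\tau_1^{-1},\tau_2^{-1},\tau_3^{-1}}$ is $$\langle\mathcal O_{\sigma_1,\sigma_2,\sigma_3}\,\bar{\mathcal O}_{\tau_1,\tau_2,\tau_3}\rangle=\sum_{\mu_1,\mu_2\in S_n}N_1^nN_2^nN_3^n\ \delta(\mu_1\sigma_1\mu_2\tau_1^{-1}\Omega_1)\,\delta(\mu_1\sigma_2\mu_2\tau_2^{-1}\Omega_2)\,\delta(\mu_1\sigma_3\mu_2\tau_3^{-1}\Omega_3),$$ where $\Omega_a=\sum_{\sigma\in S_n}N_a^{C_\sigma-n}\,\sigma\in\mathbb C(S_n)$.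
   Context: $S_n$ is the symmetric group on $\{1,\dots,n\}$, $\mathbb C(S_n)$ its group algebra, $C_\sigma$ the number of cycles of $\sigma$ (fixed points included). $\delta:\mathbb C(S_n)\to\mathbb C$ is the linear functional equal to $1$ on the identity and $0$ on every other permutation. The observable is $$\mathcal O_{\sigma_1,\sigma_2,\sigma_3}=\sum_{i^a_m}\ \prod_{m=1}^n\Phi^{i^1_m i^2_m i^3_m}\ \prod_{m=1}^n\bar\Phi^{\,i^1_{\sigma_1(m)}i^2_{\sigma_2(m)}i^3_{\sigma_3(m)}},$$ the sum being over all $i^a_m\in\{1,\dots,N_a\}$, $a=1,2,3$, $m=1,\dots,n$. The normal-ordered two-point function $\langle\mathcal O\,\mathcal O'\rangle$ of two such observables is the sum over all Wick contractions (perfect matchings of $\Phi$'s with $\bar\Phi$'s, each matched pair replaced by the two-point function above) in which no $\Phi$ is matched with a $\bar\Phi$ belonging to the same observable; that is, the $n$ fields $\Phi$ of $\mathcal O$ are matched with the $n$ fields $\bar\Phi$ of $\mathcal O'$, and the $n$ fields $\bar\Phi$ of $\mathcal O$ with the $n$ fields $\Phi$ of $\mathcal O'$. *)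

theory Defs
  imports
    Complex_Main
    "HOL-Library.Multiset"
    "HOL-Library.FuncSet"
    "HOL-Library.Poly_Mapping"
    "HOL-Combinatorics.Permutations"
    "HOL-Combinatorics.Orbits"
begin

section \<open>Tensor fields and the polynomial algebra they generate\<close>

datatype tensor_field = Phi nat nat nat | PhiBar nat nat nat

text \<open>
  Multisets form a commutative additive monoid, so the library product on the type below
  (the monoid algebra of the monoid of monomials) makes it the commutative polynomial algebra
  over the complex numbers in the components of the tensor and of its conjugate. The
  components are treated as independent variables.
\<close>

type_synonym tensor_poly = "tensor_field multiset \<Rightarrow>\<^sub>0 complex"

definition fvar :: "tensor_field \<Rightarrow> tensor_poly" where
  "fvar x = Poly_Mapping.single {#x#} 1"

definition kron :: "nat \<Rightarrow> nat \<Rightarrow> complex" where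
  "kron i j = (if i = j then 1 else 0)"

fun propagator :: "tensor_field \<Rightarrow> tensor_field \<Rightarrow> complex" where
  "propagator (Phi i1 i2 i3) (PhiBar j1 j2 j3) = kron i1 j1 * kron i2 j2 * kron i3 j3"
| "propagator (PhiBar j1 j2 j3) (Phi i1 i2 i3) = kron i1 j1 * kron i2 j2 * kron i3 j3"
| "propagator _ _ = 0"

section \<open>Wick contractions of a product of two monomials\<close>

text \<open>
  A factor of the product \<open>A B\<close> of two monomials is a triple \<open>(b, x, k)\<close>: \<open>b\<close> tells whether it
  comes from \<open>A\<close> (\<open>False\<close>) or from \<open>B\<close> (\<open>True\<close>), \<open>x\<close> is the field, and \<open>k\<close> distinguishes the
  repeated factors \<open>x\<close> of that monomial, so that matchings are counted for labelled fields.
\<close>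

type_synonym factor = "bool \<times> tensor_field \<times> nat"

definition factors :: "tensor_field multiset \<Rightarrow> tensor_field multiset \<Rightarrow> factor set" where
  "factors A B = {(b, x, k). k < count (if b then B else A) x}"

definition field_of :: "factor \<Rightarrow> tensor_field" where
  "field_of p = fst (snd p)"

definition is_Phi :: "tensor_field \<Rightarrow> bool" where
  "is_Phi x \<longleftrightarrow> (\<exists>i1 i2 i3. x = Phi i1 i2 i3)"

definition perfect_matchings :: "'a set \<Rightarrow> 'b set \<Rightarrow> ('a \<times> 'b) set set" where
  "perfect_matchings P Q =
     {M. M \<subseteq> P \<times> Q \<and> (\<forall>p\<in>P. \<exists>!q. (p, q) \<in> M) \<and> (\<forall>q\<in>Q. \<exists>!p. (p, q) \<in> M)}"

definition wick_contractions ::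
    "tensor_field multiset \<Rightarrow> tensor_field multiset \<Rightarrow> (factor \<times> factor) set set" where
  "wick_contractions A B =
     perfect_matchings {p \<in> factors A B. is_Phi (field_of p)}
                       {q \<in> factors A B. \<not> is_Phi (field_of q)}"

definition normal_ordered_contractions ::
    "tensor_field multiset \<Rightarrow> tensor_field multiset \<Rightarrow> (factor \<times> factor) set set" where
  "normal_ordered_contractions A B =
     {M \<in> wick_contractions A B. \<forall>(p, q)\<in>M. fst p \<noteq> fst q}"

definition contraction_value :: "(factor \<times> factor) set \<Rightarrow> complex" where
  "contraction_value M = (\<Prod>(p, q)\<in>M. propagator (field_of p) (field_of q))"

text \<open>Bilinear extension from monomials to polynomials.\<close>

definition normal_ordered_two_point :: "tensor_poly \<Rightarrow> tensor_poly \<Rightarrow> complex" where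
  "normal_ordered_two_point F G =
     (\<Sum>A\<in>Poly_Mapping.keys F. \<Sum>B\<in>Poly_Mapping.keys G.
        Poly_Mapping.lookup F A * Poly_Mapping.lookup G B *
        (\<Sum>M\<in>normal_ordered_contractions A B. contraction_value M))"

section \<open>The observables\<close>

definition observable ::
    "nat \<Rightarrow> nat \<Rightarrow> nat \<Rightarrow> nat \<Rightarrow> (nat \<Rightarrow> nat) \<Rightarrow> (nat \<Rightarrow> nat) \<Rightarrow> (nat \<Rightarrow> nat) \<Rightarrow> tensor_poly" where
  "observable n N1 N2 N3 \<sigma>1 \<sigma>2 \<sigma>3 =
     (\<Sum>i1 \<in> {1..n} \<rightarrow>\<^sub>E {1..N1}. \<Sum>i2 \<in> {1..n} \<rightarrow>\<^sub>E {1..N2}. \<Sum>i3 \<in> {1..n} \<rightarrow>\<^sub>E {1..N3}.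
        (\<Prod>m = 1..n. fvar (Phi (i1 m) (i2 m) (i3 m))) *
        (\<Prod>m = 1..n. fvar (PhiBar (i1 (\<sigma>1 m)) (i2 (\<sigma>2 m)) (i3 (\<sigma>3 m)))))"

definition observable_bar ::
    "nat \<Rightarrow> nat \<Rightarrow> nat \<Rightarrow> nat \<Rightarrow> (nat \<Rightarrow> nat) \<Rightarrow> (nat \<Rightarrow> nat) \<Rightarrow> (nat \<Rightarrow> nat) \<Rightarrow> tensor_poly" where
  "observable_bar n N1 N2 N3 \<tau>1 \<tau>2 \<tau>3 = observable n N1 N2 N3 (inv \<tau>1) (inv \<tau>2) (inv \<tau>3)"

section \<open>The group algebra of the symmetric group\<close>

definition Sym :: "nat \<Rightarrow> (nat \<Rightarrow> nat) set" where
  "Sym n = {\<sigma>. \<sigma> permutes {1..n}}"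

text \<open>
  The group algebra of \<open>Sym n\<close> consists of the formal linear combinations below whose keys lie
  in \<open>Sym n\<close>. The product of permutations is composition, \<open>(\<sigma> \<tau>) m = \<sigma> (\<tau> m)\<close>.
\<close>

type_synonym perm_algebra = "(nat \<Rightarrow> nat) \<Rightarrow>\<^sub>0 complex"

definition perm_elem :: "(nat \<Rightarrow> nat) \<Rightarrow> perm_algebra" where
  "perm_elem \<sigma> = Poly_Mapping.single \<sigma> 1"

definition alg_mult :: "perm_algebra \<Rightarrow> perm_algebra \<Rightarrow> perm_algebra" (infixl \<open>\<star>\<close> 70) where
  "f \<star> g = (\<Sum>\<alpha>\<in>Poly_Mapping.keys f. \<Sum>\<beta>\<in>Poly_Mapping.keys g.
              Poly_Mapping.single (\<alpha> \<circ> \<beta>) (Poly_Mapping.lookup f \<alpha> * Poly_Mapping.lookup g \<beta>))"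

definition delta :: "perm_algebra \<Rightarrow> complex" where
  "delta f = (\<Sum>\<sigma>\<in>Poly_Mapping.keys f. Poly_Mapping.lookup f \<sigma> * (if \<sigma> = id then 1 else 0))"

text \<open>Fixed points are counted: the orbit of a fixed point is a singleton.\<close>

definition num_cycles :: "nat \<Rightarrow> (nat \<Rightarrow> nat) \<Rightarrow> nat" where
  "num_cycles n \<sigma> = card (orbit \<sigma> ` {1..n})"

definition Omega :: "nat \<Rightarrow> nat \<Rightarrow> perm_algebra" where
  "Omega n N =
     (\<Sum>\<sigma>\<in>Sym n. Poly_Mapping.single \<sigma> (of_nat N powi (int (num_cycles n \<sigma>) - int n)))"

end

theory Submission
  imports Defs
begin

text \<open>
  A normal ordered contraction amounts to two permutations: \<open>\<alpha>\<close> matches the fields \<open>\<Phi>\<close> of the first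
  observable with the conjugate fields of the second, \<open>\<beta>\<close> those of the second with the conjugate
  fields of the first. For each of the three colours the Kronecker deltas then leave the index
  functions \<open>i\<close>, \<open>j\<close> with \<open>i = j \<circ> \<tau>\<^sup>-\<^sup>1 \<circ> \<alpha>\<close> and \<open>j = i \<circ> \<sigma> \<circ> \<beta>\<close>. Such pairs correspond to functions that are
  constant on the cycles of \<open>\<pi> = \<alpha> \<sigma> \<beta> \<tau>\<^sup>-\<^sup>1\<close>, so there are \<open>N\<close> to the number of cycles of \<open>\<pi>\<close> of them,
  whereas \<open>N\<^sup>n \<delta>(\<pi> \<Omega>)\<close> is \<open>N\<close> to the number of cycles of \<open>\<pi>\<^sup>-\<^sup>1\<close>.
\<close>

section \<open>Labelled factors and matchings\<close>

text \<open>The labels that \<open>factors\<close> gives to repeated fields, without the Boolean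
  tag. Applying \<open>Pair c\<close> to such a set yields the labelled fields of one
  monomial.\<close>

definition labelled :: "'a multiset \<Rightarrow> ('a \<times> nat) set" where
  "labelled A = {(x, k). k < count A x}"

text \<open>Labels are handed out one index at a time, each index taking the first label still free
  for its value. This lets the positions \<open>1..n\<close> enumerate the labelled fields of a
  monomial even when fields repeat.\<close>

lemma ex_labelling:
  assumes "finite I"
  shows "\<exists>k. bij_betw (\<lambda>i. (x i, k i)) I (labelled (image_mset x (mset_set I)))"
  using assms
proof (induction I)
  case empty
  show ?case by (simp add: labelled_def bij_betw_def)
next
  case (insert i I)
  define A where "A = image_mset x (mset_set I)"
  obtain k where k: "bij_betw (\<lambda>i. (x i, k i)) I (labelled A)"
    using insert.IH by (auto simp: A_def)
  \<comment> \<open>The labels in use for \<open>x i\<close> are exactly the numbers below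
    \<open>count A (x i)\<close>, so this one is free and becomes valid once \<open>x i\<close> is
    added.\<close>
  define k' where "k' = k(i := count A (x i))"
  have "bij_betw (\<lambda>i. (x i, k' i)) I (labelled A)"
    using k by (rule iffD1[OF bij_betw_cong, rotated]) (use insert.hyps(2) in \<open>auto simp: k'_def\<close>)
  moreover have "(x i, k' i) \<notin> labelled A"
    by (simp add: k'_def labelled_def)
  ultimately have "bij_betw (\<lambda>i. (x i, k' i)) (insert i I) (insert (x i, k' i) (labelled A))"
    using notIn_Un_bij_betw[of i I "\<lambda>i. (x i, k' i)" "labelled A"] insert.hyps(2) by simp
  also have "insert (x i, k' i) (labelled A) = labelled (image_mset x (mset_set (insert i I)))"
    using insert.hyps by (auto simp: labelled_def k'_def A_def split: if_splits)
  finally show ?case by blast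
qed

section \<open>Perfect matchings as permutations\<close>

definition matching_of_perm :: "nat \<Rightarrow> (nat \<Rightarrow> 'a) \<Rightarrow> (nat \<Rightarrow> 'b) \<Rightarrow> (nat \<Rightarrow> nat) \<Rightarrow> ('a \<times> 'b) set" where
  "matching_of_perm n e f \<alpha> = (\<lambda>m. (e m, f (\<alpha> m))) ` {1..n}"

text \<open>A perfect matching is the graph of a bijection from \<open>P\<close> to
  \<open>Q\<close>, which the enumerations \<open>e\<close> and \<open>f\<close> transport to a
  bijection of \<open>{1..n}\<close>. The permutation is unique because elements of
  \<open>Sym n\<close> fix everything outside \<open>{1..n}\<close>.\<close>

lemma bij_betw_matching_of_perm:
  assumes e: "bij_betw e {1..n} P" and f: "bij_betw f {1..n} Q"
  shows "bij_betw (matching_of_perm n e f) (Sym n) (perfect_matchings P Q)"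
proof (rule bij_betwI')
  fix \<alpha> \<beta> assume a: "\<alpha> \<in> Sym n" "\<beta> \<in> Sym n"
  show "matching_of_perm n e f \<alpha> = matching_of_perm n e f \<beta> \<longleftrightarrow> \<alpha> = \<beta>"
  proof
    assume eq: "matching_of_perm n e f \<alpha> = matching_of_perm n e f \<beta>"
    show "\<alpha> = \<beta>"
    proof
      fix m
      show "\<alpha> m = \<beta> m"
      proof (cases "m \<in> {1..n}")
        case True
        hence "(e m, f (\<alpha> m)) \<in> matching_of_perm n e f \<beta>"
          unfolding eq[symmetric] by (auto simp: matching_of_perm_def)
        then obtain k where k: "k \<in> {1..n}" "e m = e k" "f (\<alpha> m) = f (\<beta> k)"
          by (auto simp: matching_of_perm_def)
        have "m = k" using inj_onD[OF bij_betw_imp_inj_on[OF e] k(2) True k(1)] .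
        moreover have "\<alpha> m \<in> {1..n}" "\<beta> k \<in> {1..n}"
          using a permutes_in_image[of \<alpha> "{1..n}" m] permutes_in_image[of \<beta> "{1..n}" k] True k(1)
          by (simp_all only: Sym_def mem_Collect_eq)
        ultimately show ?thesis using inj_onD[OF bij_betw_imp_inj_on[OF f] k(3)] by simp
      next
        case False
        thus ?thesis using a by (auto simp: Sym_def permutes_def)
      qed
    qed
  qed simp
next
  fix \<alpha> assume "\<alpha> \<in> Sym n"
  hence \<alpha>: "bij_betw \<alpha> {1..n} {1..n}" by (simp add: Sym_def permutes_imp_bij)
  have fa: "bij_betw (\<lambda>m. f (\<alpha> m)) {1..n} Q"
    using bij_betw_trans[OF \<alpha> f] by (simp add: comp_def)
  have mem: "(p, q) \<in> matching_of_perm n e f \<alpha> \<longleftrightarrow> (\<exists>k\<in>{1..n}. p = e k \<and> q = f (\<alpha> k))" for p q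
    unfolding matching_of_perm_def by blast
  have "\<exists>!q. (p, q) \<in> matching_of_perm n e f \<alpha>" if "p \<in> P" for p
  proof -
    obtain m where "m \<in> {1..n}" "p = e m" using bij_betw_imp_surj_on[OF e] \<open>p \<in> P\<close> by blast
    thus ?thesis
      unfolding mem using inj_onD[OF bij_betw_imp_inj_on[OF e]] by blast
  qed
  moreover have "\<exists>!p. (p, q) \<in> matching_of_perm n e f \<alpha>" if "q \<in> Q" for q
  proof -
    obtain m where "m \<in> {1..n}" "q = f (\<alpha> m)" using bij_betw_imp_surj_on[OF fa] \<open>q \<in> Q\<close> by blast
    thus ?thesis
      unfolding mem using inj_onD[OF bij_betw_imp_inj_on[OF fa]] by blast
  qed
  moreover have "matching_of_perm n e f \<alpha> \<subseteq> P \<times> Q"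
    using e fa by (auto simp: matching_of_perm_def bij_betw_def)
  ultimately show "matching_of_perm n e f \<alpha> \<in> perfect_matchings P Q"
    by (simp add: perfect_matchings_def)
next
  fix M assume M: "M \<in> perfect_matchings P Q"
  \<comment> \<open>The bijection from \<open>P\<close> to \<open>Q\<close> whose graph is
    \<open>M\<close>.\<close>
  define g where "g p = (THE q. (p, q) \<in> M)" for p
  have M1: "\<exists>!q. (p, q) \<in> M" if "p \<in> P" for p using M that by (auto simp: perfect_matchings_def)
  have M2: "\<exists>!p. (p, q) \<in> M" if "q \<in> Q" for q using M that by (auto simp: perfect_matchings_def)
  have sub: "M \<subseteq> P \<times> Q" using M by (auto simp: perfect_matchings_def)
  have gM: "(p, g p) \<in> M" if "p \<in> P" for p
    unfolding g_def using theI'[OF M1[OF that]] .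
  have gu: "q = g p" if "(p, q) \<in> M" for p q
    using that gM M1 sub by blast
  have g: "bij_betw g P Q"
  proof (rule bij_betwI')
    show "g x = g y \<longleftrightarrow> x = y" if "x \<in> P" "y \<in> P" for x y
      using gM[OF that(1)] gM[OF that(2)] M2 sub by force
    show "g x \<in> Q" if "x \<in> P" for x using gM[OF that] sub by blast
    show "\<exists>x\<in>P. y = g x" if "y \<in> Q" for y using M2[OF that] gu sub by blast
  qed
  define h where "h = inv_into {1..n} f"
  have h: "bij_betw h Q {1..n}" unfolding h_def by (rule bij_betw_inv_into[OF f])
  \<comment> \<open>The transported bijection, extended by the identity as membership in
    \<open>Sym n\<close> demands.\<close>
  define \<alpha> where "\<alpha> m = (if m \<in> {1..n} then h (g (e m)) else m)" for m
  have "bij_betw (h \<circ> (g \<circ> e)) {1..n} {1..n}"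
    using bij_betw_trans[OF bij_betw_trans[OF e g] h] .
  hence "bij_betw \<alpha> {1..n} {1..n}"
    by (rule iffD1[OF bij_betw_cong, rotated]) (simp add: \<alpha>_def)
  hence \<alpha>: "\<alpha> \<in> Sym n"
    unfolding Sym_def mem_Collect_eq by (rule bij_imp_permutes) (auto simp: \<alpha>_def)
  have fal: "f (\<alpha> m) = g (e m)" if "m \<in> {1..n}" for m
  proof -
    have "g (e m) \<in> Q" using that e g by (auto simp: bij_betw_def)
    thus ?thesis using that f by (auto simp: \<alpha>_def h_def bij_betw_def f_inv_into_f)
  qed
  have "M = matching_of_perm n e f \<alpha>"
  proof (intro equalityI subsetI)
    fix x assume x: "x \<in> M"
    obtain p q where pq: "x = (p, q)" by fastforce
    obtain m where m: "m \<in> {1..n}" "p = e m" using x pq sub e by (auto simp: bij_betw_def)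
    have "q = g p" using gu x pq by simp
    thus "x \<in> matching_of_perm n e f \<alpha>" using m fal pq by (auto simp: matching_of_perm_def)
  next
    fix x assume "x \<in> matching_of_perm n e f \<alpha>"
    then obtain m where m: "m \<in> {1..n}" "x = (e m, f (\<alpha> m))" by (auto simp: matching_of_perm_def)
    have "e m \<in> P" using m e by (auto simp: bij_betw_def)
    thus "x \<in> M" using gM m fal by simp
  qed
  thus "\<exists>\<alpha>\<in>Sym n. M = matching_of_perm n e f \<alpha>" using \<alpha> by blast
qed

text \<open>Intersection with the two rectangles inverts the union, since disjointness confines the
  pairs at each element to a single rectangle. With the indices 1 and 2 standing for the two
  monomials, the right-hand side is the normal ordering condition, and its matchings split into two
  independent ones.\<close>

lemma bij_betw_Un_perfect_matchings:
  assumes "P1 \<inter> P2 = {}" "Q1 \<inter> Q2 = {}"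
  shows "bij_betw (\<lambda>(M1, M2). M1 \<union> M2) (perfect_matchings P1 Q2 \<times> perfect_matchings P2 Q1)
           {M \<in> perfect_matchings (P1 \<union> P2) (Q1 \<union> Q2). M \<subseteq> P1 \<times> Q2 \<union> P2 \<times> Q1}"
proof (rule bij_betwI[where g = "\<lambda>M. (M \<inter> P1 \<times> Q2, M \<inter> P2 \<times> Q1)"])
  show "(\<lambda>(M1, M2). M1 \<union> M2) \<in> perfect_matchings P1 Q2 \<times> perfect_matchings P2 Q1 \<rightarrow>
           {M \<in> perfect_matchings (P1 \<union> P2) (Q1 \<union> Q2). M \<subseteq> P1 \<times> Q2 \<union> P2 \<times> Q1}"
  proof safe
    fix M1 M2
    assume M: "M1 \<in> perfect_matchings P1 Q2" "M2 \<in> perfect_matchings P2 Q1"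
    have s: "M1 \<subseteq> P1 \<times> Q2" "M2 \<subseteq> P2 \<times> Q1" using M by (auto simp: perfect_matchings_def)
    have "\<exists>!q. (p, q) \<in> M1 \<union> M2" if "p \<in> P1 \<union> P2" for p
    proof (cases "p \<in> P1")
      case True
      hence "(p, q) \<notin> M2" for q using s assms by blast
      thus ?thesis using M(1) True by (simp add: perfect_matchings_def)
    next
      case False
      hence "(p, q) \<notin> M1" for q using s by blast
      thus ?thesis using M(2) False that by (simp add: perfect_matchings_def)
    qed
    moreover have "\<exists>!p. (p, q) \<in> M1 \<union> M2" if "q \<in> Q1 \<union> Q2" for q
    proof (cases "q \<in> Q1")
      case True
      hence "(p, q) \<notin> M1" for p using s assms by blast
      thus ?thesis using M(2) True by (simp add: perfect_matchings_def)
    next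
      case False
      hence "(p, q) \<notin> M2" for p using s by blast
      thus ?thesis using M(1) False that by (simp add: perfect_matchings_def)
    qed
    ultimately show "M1 \<union> M2 \<in> perfect_matchings (P1 \<union> P2) (Q1 \<union> Q2)"
      using s by (auto simp: perfect_matchings_def)
  qed (auto simp: perfect_matchings_def)
  show "(\<lambda>M. (M \<inter> P1 \<times> Q2, M \<inter> P2 \<times> Q1)) \<in>
          {M \<in> perfect_matchings (P1 \<union> P2) (Q1 \<union> Q2). M \<subseteq> P1 \<times> Q2 \<union> P2 \<times> Q1} \<rightarrow>
          perfect_matchings P1 Q2 \<times> perfect_matchings P2 Q1"
  proof safe
    fix M assume M: "M \<in> perfect_matchings (P1 \<union> P2) (Q1 \<union> Q2)" and s: "M \<subseteq> P1 \<times> Q2 \<union> P2 \<times> Q1"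
    have 1: "\<exists>!q. (p, q) \<in> M" if "p \<in> P1 \<union> P2" for p using M that by (simp add: perfect_matchings_def)
    have 2: "\<exists>!p. (p, q) \<in> M" if "q \<in> Q1 \<union> Q2" for q using M that by (simp add: perfect_matchings_def)
    \<comment> \<open>At an element of \<open>P1\<close> or of \<open>Q2\<close> the restriction
      loses no partner, so existence and uniqueness carry over from \<open>M\<close>.\<close>
    have eq: "(p, q) \<in> M \<inter> P1 \<times> Q2 \<longleftrightarrow> (p, q) \<in> M" if "p \<in> P1 \<or> q \<in> Q2" for p q
      using that s assms by blast
    show "M \<inter> P1 \<times> Q2 \<in> perfect_matchings P1 Q2"
      unfolding perfect_matchings_def mem_Collect_eq
      using 1 2 by (auto simp: eq simp del: Int_iff)
    have eq: "(p, q) \<in> M \<inter> P2 \<times> Q1 \<longleftrightarrow> (p, q) \<in> M" if "p \<in> P2 \<or> q \<in> Q1" for p q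
      using that s assms by blast
    show "M \<inter> P2 \<times> Q1 \<in> perfect_matchings P2 Q1"
      unfolding perfect_matchings_def mem_Collect_eq
      using 1 2 by (auto simp: eq simp del: Int_iff)
  qed
next
  fix x assume "x \<in> perfect_matchings P1 Q2 \<times> perfect_matchings P2 Q1"
  then obtain M1 M2 where x: "x = (M1, M2)" and "M1 \<subseteq> P1 \<times> Q2" "M2 \<subseteq> P2 \<times> Q1"
    by (auto simp: perfect_matchings_def)
  hence "(M1 \<union> M2) \<inter> P1 \<times> Q2 = M1" "(M1 \<union> M2) \<inter> P2 \<times> Q1 = M2"
    using assms by blast+
  thus "(\<lambda>M. (M \<inter> P1 \<times> Q2, M \<inter> P2 \<times> Q1)) ((\<lambda>(M1, M2). M1 \<union> M2) x) = x"
    by (simp add: x)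
next
  fix M assume "M \<in> {M \<in> perfect_matchings (P1 \<union> P2) (Q1 \<union> Q2). M \<subseteq> P1 \<times> Q2 \<union> P2 \<times> Q1}"
  hence "M \<subseteq> P1 \<times> Q2 \<union> P2 \<times> Q1" by simp
  hence "M \<inter> P1 \<times> Q2 \<union> M \<inter> P2 \<times> Q1 = M" by blast
  thus "(\<lambda>(M1, M2). M1 \<union> M2) ((\<lambda>M. (M \<inter> P1 \<times> Q2, M \<inter> P2 \<times> Q1)) M) = M" by simp
qed

section \<open>Normal-ordered contractions of two monomials\<close>

lemma finite_Sym: "finite (Sym n)"
  by (simp add: Sym_def finite_permutations)

text \<open>Every \<open>\<Phi>\<close> of one monomial must meet a conjugate field of the other.
  The two directions are chosen independently and each is given by a permutation, so the sum
  factorises.\<close>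

lemma sum_normal_ordered_contractions:
  fixes a a' b b' :: "nat \<Rightarrow> tensor_field"
    and n :: nat
  assumes Phi: "\<And>m. is_Phi (a m)" "\<And>m. is_Phi (b m)"
    and PhiBar: "\<And>m. \<not> is_Phi (a' m)" "\<And>m. \<not> is_Phi (b' m)"
  defines "mon \<equiv> \<lambda>x :: nat \<Rightarrow> tensor_field. image_mset x (mset_set {1..n})"
  shows "(\<Sum>M\<in>normal_ordered_contractions (mon a + mon a') (mon b + mon b'). contraction_value M) =
         (\<Sum>\<alpha>\<in>Sym n. \<Prod>m=1..n. propagator (a m) (b' (\<alpha> m))) *
         (\<Sum>\<beta>\<in>Sym n. \<Prod>m=1..n. propagator (b m) (a' (\<beta> m)))"
proof -
  \<comment> \<open>The labelled fields of \<open>mon x\<close>, tagged with the monomial they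
    belong to: \<open>False\<close> for the first, \<open>True\<close> for the second.\<close>
  define L where "L c x = Pair c ` labelled (mon x)" for c :: bool and x
  have "\<exists>e. bij_betw e {1..n} (L c x) \<and> (\<forall>m. field_of (e m) = x m)" for c x
  proof -
    obtain k where "bij_betw (\<lambda>i. (x i, k i)) {1..n} (labelled (mon x))"
      using ex_labelling[of "{1..n}" x] by (auto simp: mon_def)
    moreover have "bij_betw (Pair c) (labelled (mon x)) (L c x)"
      by (simp add: L_def bij_betw_def inj_on_def)
    ultimately have "bij_betw (Pair c \<circ> (\<lambda>i. (x i, k i))) {1..n} (L c x)" by (rule bij_betw_trans)
    thus ?thesis by (intro exI[of _ "Pair c \<circ> (\<lambda>i. (x i, k i))"]) (simp add: field_of_def)
  qed
  then obtain e where e: "\<And>c x. bij_betw (e c x) {1..n} (L c x)" "\<And>c x m. field_of (e c x m) = x m"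
    by metis
  have c0: "count (mon x) y = 0" if "y \<notin> range x" for x y
    using that by (auto simp: mon_def count_eq_zero_iff)
  \<comment> \<open>A \<open>\<Phi>\<close> has multiplicity 0 in the conjugate parts and
    conversely. Hence its multiplicity in the whole monomial is that in its own part, and the labels
    in \<open>factors\<close> agree with those in \<open>L\<close>.\<close>
  have cA: "count (mon a) y = 0" "count (mon b) y = 0" if "\<not> is_Phi y" for y
    using that Phi by (auto intro!: c0)
  have cB: "count (mon a') y = 0" "count (mon b') y = 0" if "is_Phi y" for y
    using that PhiBar by (auto intro!: c0)
  have P: "{p \<in> factors (mon a + mon a') (mon b + mon b'). is_Phi (field_of p)} = L False a \<union> L True b"
    using cA cB by (force simp: factors_def field_of_def L_def labelled_def split: if_splits)
  have Q: "{p \<in> factors (mon a + mon a') (mon b + mon b'). \<not> is_Phi (field_of p)} = L False a' \<union> L True b'"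
    using cA cB by (force simp: factors_def field_of_def L_def labelled_def split: if_splits)
  define X1 where "X1 = perfect_matchings (L False a) (L True b')"
  define X2 where "X2 = perfect_matchings (L True b) (L False a')"
  have N: "normal_ordered_contractions (mon a + mon a') (mon b + mon b') =
     {M \<in> perfect_matchings (L False a \<union> L True b) (L False a' \<union> L True b').
        M \<subseteq> L False a \<times> L True b' \<union> L True b \<times> L False a'}"
  proof -
    have "(\<forall>(p, q)\<in>M. fst p \<noteq> fst q) \<longleftrightarrow> M \<subseteq> L False a \<times> L True b' \<union> L True b \<times> L False a'"
      if "M \<in> perfect_matchings (L False a \<union> L True b) (L False a' \<union> L True b')" for M
    proof -
      have "M \<subseteq> (L False a \<union> L True b) \<times> (L False a' \<union> L True b')"
        using that by (simp add: perfect_matchings_def)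
      \<comment> \<open>The tags of a pair differ exactly when it joins the \<open>\<Phi>\<close>
        part of one monomial to the conjugate part of the other.\<close>
      moreover have "fst (fst x) \<noteq> fst (snd x) \<longleftrightarrow> x \<in> L False a \<times> L True b' \<union> L True b \<times> L False a'"
        if "x \<in> (L False a \<union> L True b) \<times> (L False a' \<union> L True b')" for x
        using that by (auto simp: L_def)
      ultimately have "(\<forall>x\<in>M. fst (fst x) \<noteq> fst (snd x)) \<longleftrightarrow>
          (\<forall>x\<in>M. x \<in> L False a \<times> L True b' \<union> L True b \<times> L False a')"
        by (intro ball_cong refl) (simp only: subset_eq)
      thus ?thesis unfolding subset_eq case_prod_unfold .
    qed
    thus ?thesis
      unfolding normal_ordered_contractions_def wick_contractions_def P Q
      by (intro Collect_cong conj_cong refl)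
  qed
  have dis: "L False x \<inter> L True y = {}" for x y by (auto simp: L_def)
  have fin: "finite M" if "M \<in> perfect_matchings (L c x) (L d y)" for M c d x y
  proof (rule finite_subset)
    show "M \<subseteq> L c x \<times> L d y" using that by (simp add: perfect_matchings_def)
    show "finite (L c x \<times> L d y)" using e(1) by (metis bij_betw_finite finite_atLeastAtMost finite_SigmaI)
  qed
  have part: "(\<Sum>M\<in>perfect_matchings (L c x) (L d y). contraction_value M) =
     (\<Sum>\<alpha>\<in>Sym n. \<Prod>m=1..n. propagator (x m) (y (\<alpha> m)))" for c d x y
  proof -
    have "(\<Sum>M\<in>perfect_matchings (L c x) (L d y). contraction_value M) =
       (\<Sum>\<alpha>\<in>Sym n. contraction_value (matching_of_perm n (e c x) (e d y) \<alpha>))"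
      by (rule sum.reindex_bij_betw[OF bij_betw_matching_of_perm, symmetric]) (rule e)+
    also have "\<dots> = (\<Sum>\<alpha>\<in>Sym n. \<Prod>m=1..n. propagator (x m) (y (\<alpha> m)))"
    proof (rule sum.cong[OF refl])
      fix \<alpha>
      \<comment> \<open>The first components already differ for different \<open>m\<close>, so the
        product over the matching can be taken over positions.\<close>
      have "inj_on (\<lambda>m. (e c x m, e d y (\<alpha> m))) {1..n}"
        using bij_betw_imp_inj_on[OF e(1)[of c x]] unfolding inj_on_def by blast
      thus "contraction_value (matching_of_perm n (e c x) (e d y) \<alpha>) =
          (\<Prod>m=1..n. propagator (x m) (y (\<alpha> m)))"
        by (simp add: contraction_value_def matching_of_perm_def prod.reindex e(2))
    qed
    finally show ?thesis .
  qed
  have "(\<Sum>M\<in>normal_ordered_contractions (mon a + mon a') (mon b + mon b'). contraction_value M) =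
     (\<Sum>(M1, M2)\<in>X1 \<times> X2. contraction_value (M1 \<union> M2))"
    unfolding N X1_def X2_def
    using sum.reindex_bij_betw[OF bij_betw_Un_perfect_matchings[OF dis dis], of contraction_value, symmetric]
    by (simp add: case_prod_unfold)
  also have "\<dots> = (\<Sum>(M1, M2)\<in>X1 \<times> X2. contraction_value M1 * contraction_value M2)"
  proof (rule sum.cong[OF refl], clarify)
    fix M1 M2 assume M: "M1 \<in> X1" "M2 \<in> X2"
    have "M1 \<subseteq> L False a \<times> L True b'" "M2 \<subseteq> L True b \<times> L False a'"
      using M by (auto simp: X1_def X2_def perfect_matchings_def)
    hence "M1 \<inter> M2 = {}" using dis by blast
    thus "contraction_value (M1 \<union> M2) = contraction_value M1 * contraction_value M2"
      unfolding contraction_value_def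
      using M fin by (intro prod.union_disjoint) (auto simp: X1_def X2_def)
  qed
  also have "\<dots> = (\<Sum>M\<in>X1. contraction_value M) * (\<Sum>M\<in>X2. contraction_value M)"
    by (simp add: sum_product sum.cartesian_product)
  finally show ?thesis unfolding X1_def X2_def part .
qed

section \<open>Bilinear extension\<close>

lemma sum_keys_superset:
  fixes h :: "'a \<Rightarrow> complex"
  assumes "finite K" "Poly_Mapping.keys F \<subseteq> K"
  shows "(\<Sum>A\<in>Poly_Mapping.keys F. Poly_Mapping.lookup F A * h A) = (\<Sum>A\<in>K. Poly_Mapping.lookup F A * h A)"
  using assms by (intro sum.mono_neutral_left) (auto simp: in_keys_iff)

text \<open>The values \<open>x i\<close> may coincide: the coefficient at \<open>A\<close> counts
  the indices \<open>i\<close> with \<open>x i = A\<close>. Exchanging the sums gives each index its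
  own term, so no like monomials have to be collected.\<close>

lemma sum_keys_sum_single:
  fixes h :: "'a \<Rightarrow> complex" and x :: "'i \<Rightarrow> 'a"
  assumes "finite I"
  defines "F \<equiv> \<Sum>i\<in>I. Poly_Mapping.single (x i) 1"
  shows "(\<Sum>A\<in>Poly_Mapping.keys F. Poly_Mapping.lookup F A * h A) = (\<Sum>i\<in>I. h (x i))"
proof -
  have "Poly_Mapping.keys F \<subseteq> x ` I"
    using keys_sum[of "\<lambda>i. Poly_Mapping.single (x i) (1::complex)" I] by (auto simp: F_def)
  hence "(\<Sum>A\<in>Poly_Mapping.keys F. Poly_Mapping.lookup F A * h A) =
      (\<Sum>A\<in>x ` I. Poly_Mapping.lookup F A * h A)"
    using assms by (intro sum_keys_superset) auto
  also have "\<dots> = (\<Sum>A\<in>x ` I. \<Sum>i\<in>I. if A = x i then h A else 0)"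
    by (intro sum.cong refl)
       (auto simp: F_def lookup_sum sum_distrib_right lookup_single when_def intro!: sum.cong)
  also have "\<dots> = (\<Sum>i\<in>I. \<Sum>A\<in>x ` I. if A = x i then h A else 0)" by (rule sum.swap)
  also have "\<dots> = (\<Sum>i\<in>I. h (x i))" using assms by (intro sum.cong) (auto simp: sum.delta')
  finally show ?thesis .
qed

lemma normal_ordered_two_point_sum_single:
  assumes "finite I" "finite J"
  shows "normal_ordered_two_point (\<Sum>i\<in>I. Poly_Mapping.single (x i) 1) (\<Sum>j\<in>J. Poly_Mapping.single (y j) 1) =
    (\<Sum>i\<in>I. \<Sum>j\<in>J. \<Sum>M\<in>normal_ordered_contractions (x i) (y j). contraction_value M)"
proof -
  define W where "W A B = (\<Sum>M\<in>normal_ordered_contractions A B. contraction_value M)" for A B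
  define F G :: tensor_poly where
    "F = (\<Sum>i\<in>I. Poly_Mapping.single (x i) 1)" and "G = (\<Sum>j\<in>J. Poly_Mapping.single (y j) 1)"
  have "normal_ordered_two_point F G =
     (\<Sum>A\<in>Poly_Mapping.keys F. Poly_Mapping.lookup F A *
        (\<Sum>B\<in>Poly_Mapping.keys G. Poly_Mapping.lookup G B * W A B))"
    by (simp add: normal_ordered_two_point_def W_def sum_distrib_left mult.assoc)
  also have "\<dots> = (\<Sum>i\<in>I. \<Sum>j\<in>J. W (x i) (y j))"
    unfolding F_def G_def by (simp add: sum_keys_sum_single assms)
  finally show ?thesis by (simp add: F_def G_def W_def)
qed

lemma prod_fvar:
  "finite I \<Longrightarrow> (\<Prod>i\<in>I. fvar (x i)) = Poly_Mapping.single (image_mset x (mset_set I)) 1"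
proof (induction I rule: finite_induct)
  case empty
  show ?case by (simp flip: single_one)
next
  case (insert i I)
  thus ?case by (simp add: fvar_def mult_single)
qed

section \<open>Counting colourings invariant under a permutation\<close>

text \<open>The index functions of one tensor slot, extensional as in \<open>observable\<close>, so
  that they form a finite set.\<close>

definition colourings :: "nat \<Rightarrow> nat \<Rightarrow> (nat \<Rightarrow> nat) set" where
  "colourings n N = {1..n} \<rightarrow>\<^sub>E {1..N}"

definition invariant_colourings :: "nat \<Rightarrow> nat \<Rightarrow> (nat \<Rightarrow> nat) \<Rightarrow> (nat \<Rightarrow> nat) set" where
  "invariant_colourings n N \<pi> = {f \<in> colourings n N. \<forall>m\<in>{1..n}. f (\<pi> m) = f m}"

text \<open>An invariant function is constant on every cycle, and its values on the cycles are
  arbitrary. It is therefore the same as a function from the set of cycles to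
  \<open>{1..N}\<close>.\<close>

lemma card_invariant_colourings:
  assumes "\<pi> \<in> Sym n"
  shows "card (invariant_colourings n N \<pi>) = N ^ num_cycles n \<pi>"
proof -
  have \<pi>: "\<pi> permutes {1..n}" using assms by (simp add: Sym_def)
  have perm: "permutation \<pi>" using \<pi> by (auto simp: permutation_permutes)
  define O' where "O' = orbit \<pi> ` {1..n}"
  \<comment> \<open>\<open>orbit\<close> starts at \<open>\<pi> m\<close>. That it returns to
    \<open>m\<close> uses that \<open>\<pi>\<close> is a permutation moving finitely many
    points.\<close>
  have self: "m \<in> orbit \<pi> m" for m using perm by (rule permutation_self_in_orbit)
  have sub: "orbit \<pi> m \<subseteq> {1..n}" if "m \<in> {1..n}" for m
    using that \<pi> by (rule permutes_orbit_subset[rotated])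
  have const: "f k = f m" if f: "f \<in> invariant_colourings n N \<pi>" and m: "m \<in> {1..n}"
      and k: "k \<in> orbit \<pi> m" for f k m
    using k
  proof induction
    case base
    show ?case using f m by (auto simp: invariant_colourings_def)
  next
    case (step y)
    thus ?case using f sub[OF m] by (auto simp: invariant_colourings_def)
  qed
  have orb: "orbit \<pi> k = orbit \<pi> m" if "k \<in> orbit \<pi> m" for k m
    using that perm by (metis cyclic_on_orbit' orbit_cyclic_eq3)
  have "bij_betw (\<lambda>F. \<lambda>m\<in>{1..n}. F (orbit \<pi> m)) (O' \<rightarrow>\<^sub>E {1..N}) (invariant_colourings n N \<pi>)"
  \<comment> \<open>The inverse evaluates \<open>f\<close> at an arbitrarily chosen point of each
    cycle. By \<open>const\<close> the choice does not affect the value.\<close>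
  proof (rule bij_betwI[where g = "\<lambda>f. \<lambda>o'\<in>O'. f (SOME m. m \<in> o')"])
    show "(\<lambda>F. \<lambda>m\<in>{1..n}. F (orbit \<pi> m)) \<in> (O' \<rightarrow>\<^sub>E {1..N}) \<rightarrow> invariant_colourings n N \<pi>"
    proof
      fix F assume F: "F \<in> O' \<rightarrow>\<^sub>E {1..N}"
      have "\<pi> m \<in> {1..n} \<and> orbit \<pi> (\<pi> m) = orbit \<pi> m" if "m \<in> {1..n}" for m
        using that orb[OF orbit.base] permutes_in_image[OF \<pi>] by blast
      thus "(\<lambda>m\<in>{1..n}. F (orbit \<pi> m)) \<in> invariant_colourings n N \<pi>"
        using F by (auto simp: invariant_colourings_def colourings_def O'_def Pi_iff)
    qed
    have some: "(SOME k. k \<in> orbit \<pi> m) \<in> orbit \<pi> m" for m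
      using self by (metis someI)
    show "(\<lambda>f. \<lambda>o'\<in>O'. f (SOME m. m \<in> o')) \<in> invariant_colourings n N \<pi> \<rightarrow> O' \<rightarrow>\<^sub>E {1..N}"
      using some sub unfolding O'_def
      by (fastforce simp: invariant_colourings_def colourings_def)
    show "(\<lambda>o'\<in>O'. (\<lambda>m\<in>{1..n}. F (orbit \<pi> m)) (SOME m. m \<in> o')) = F"
      if F: "F \<in> O' \<rightarrow>\<^sub>E {1..N}" for F
    proof
      fix o'
      show "(\<lambda>o'\<in>O'. (\<lambda>m\<in>{1..n}. F (orbit \<pi> m)) (SOME m. m \<in> o')) o' = F o'"
      proof (cases "o' \<in> O'")
        case True
        then obtain m where m: "m \<in> {1..n}" "o' = orbit \<pi> m" by (auto simp: O'_def)
        show ?thesis using True m some[of m] sub[of m] orb[of _ m] by auto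
      next
        case False
        thus ?thesis using F by (auto simp: PiE_def extensional_def)
      qed
    qed
    show "(\<lambda>m\<in>{1..n}. (\<lambda>o'\<in>O'. f (SOME m. m \<in> o')) (orbit \<pi> m)) = f"
      if f: "f \<in> invariant_colourings n N \<pi>" for f
    proof
      fix m
      show "(\<lambda>m\<in>{1..n}. (\<lambda>o'\<in>O'. f (SOME m. m \<in> o')) (orbit \<pi> m)) m = f m"
      proof (cases "m \<in> {1..n}")
        case True
        thus ?thesis using const[OF f _ some, of m] by (simp add: O'_def)
      next
        case False
        thus ?thesis using f by (auto simp: invariant_colourings_def colourings_def PiE_def extensional_def)
      qed
    qed
  qed
  hence "card (invariant_colourings n N \<pi>) = card (O' \<rightarrow>\<^sub>E {1..N})"
    by (simp add: bij_betw_same_card)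
  also have "\<dots> = N ^ num_cycles n \<pi>"
    by (simp add: card_PiE O'_def num_cycles_def)
  finally show ?thesis .
qed

text \<open>Invariance under a permutation and under its inverse are the same condition. This
  bridges the inverse produced by \<open>delta\<close> without a comparison of the cycles of the two
  permutations.\<close>

lemma invariant_colourings_inv:
  assumes "\<pi> \<in> Sym n"
  shows "invariant_colourings n N (inv \<pi>) = invariant_colourings n N \<pi>"
proof -
  have \<pi>: "\<pi> permutes {1..n}" using assms by (simp add: Sym_def)
  have "(\<forall>m\<in>{1..n}. f (inv \<pi> m) = f m) \<longleftrightarrow> (\<forall>m\<in>{1..n}. f (\<pi> m) = f m)" for f :: "nat \<Rightarrow> nat"
    using permutes_inverses[OF \<pi>] permutes_in_image[OF \<pi>] permutes_in_image[OF permutes_inv[OF \<pi>]]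
    by metis
  thus ?thesis by (simp add: invariant_colourings_def)
qed

text \<open>A linked pair \<open>(i, j)\<close> is encoded by \<open>h = j \<circ> \<tau>\<close>.\<close>

lemma card_linked_functions:
  fixes D :: "'a set" and R :: "'b set"
  assumes p: "\<alpha> permutes D" "\<beta> permutes D" "\<sigma> permutes D" "\<tau> permutes D"
  shows "card {(i, j). i \<in> D \<rightarrow>\<^sub>E R \<and> j \<in> D \<rightarrow>\<^sub>E R \<and>
            (\<forall>m\<in>D. i m = j (\<tau> (\<alpha> m))) \<and> (\<forall>m\<in>D. j m = i (\<sigma> (\<beta> m)))} =
         card {h \<in> D \<rightarrow>\<^sub>E R. \<forall>m\<in>D. h (\<alpha> (\<sigma> (\<beta> (\<tau> m)))) = h m}"
    (is "card ?S = card ?T")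
proof (rule bij_betw_same_card, rule bij_betwI)
  note im = permutes_in_image[OF p(1)] permutes_in_image[OF p(2)] permutes_in_image[OF p(3)]
    permutes_in_image[OF p(4)] permutes_in_image[OF permutes_inv[OF p(4)]]
  note inv = permutes_inverses[OF p(4)]
  show "(\<lambda>(i, j). \<lambda>m\<in>D. j (\<tau> m)) \<in> ?S \<rightarrow> ?T"
  proof
    fix x assume x: "x \<in> ?S"
    obtain i j where ij: "x = (i, j)" by (cases x)
    have S: "j \<in> D \<rightarrow>\<^sub>E R" "\<And>m. m \<in> D \<Longrightarrow> i m = j (\<tau> (\<alpha> m))" "\<And>m. m \<in> D \<Longrightarrow> j m = i (\<sigma> (\<beta> m))"
      using x by (simp_all only: ij mem_Collect_eq prod.case)
    \<comment> \<open>The index function \<open>i\<close> is eliminated: the first link is used at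
      \<open>\<sigma> (\<beta> (\<tau> m))\<close>, the second at \<open>\<tau> m\<close>.\<close>
    have "j (\<tau> (\<alpha> (\<sigma> (\<beta> (\<tau> m))))) = j (\<tau> m)" if "m \<in> D" for m
      using S(2)[of "\<sigma> (\<beta> (\<tau> m))"] S(3)[of "\<tau> m"] that by (simp add: im)
    thus "(\<lambda>(i, j). \<lambda>m\<in>D. j (\<tau> m)) x \<in> ?T"
      using S(1) by (auto simp: ij im PiE_mem)
  qed
  show "(\<lambda>h. (\<lambda>m\<in>D. h (\<alpha> m), \<lambda>m\<in>D. h (inv \<tau> m))) \<in> ?T \<rightarrow> ?S"
  proof
    fix h assume h: "h \<in> ?T"
    \<comment> \<open>Invariance of \<open>h\<close> at \<open>inv \<tau> m\<close> is the second
      link for \<open>i = h \<circ> \<alpha>\<close> and \<open>j = h \<circ> inv \<tau>\<close>.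
      The first link is immediate.\<close>
    have "h (inv \<tau> m) = h (\<alpha> (\<sigma> (\<beta> m)))" if "m \<in> D" for m
    proof -
      have "inv \<tau> m \<in> D" using that by (simp add: im)
      hence "h (\<alpha> (\<sigma> (\<beta> (\<tau> (inv \<tau> m))))) = h (inv \<tau> m)" using h by blast
      thus ?thesis by (simp add: inv)
    qed
    thus "(\<lambda>m\<in>D. h (\<alpha> m), \<lambda>m\<in>D. h (inv \<tau> m)) \<in> ?S"
      using h by (auto simp: im inv PiE_mem)
  qed
  show "(\<lambda>h. (\<lambda>m\<in>D. h (\<alpha> m), \<lambda>m\<in>D. h (inv \<tau> m))) ((\<lambda>(i, j). \<lambda>m\<in>D. j (\<tau> m)) x) = x"
    if x: "x \<in> ?S" for x
  proof -
    obtain i j where ij: "x = (i, j)" by (cases x)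
    have S: "i \<in> D \<rightarrow>\<^sub>E R" "j \<in> D \<rightarrow>\<^sub>E R" "\<forall>m\<in>D. i m = j (\<tau> (\<alpha> m))"
      using x unfolding ij mem_Collect_eq prod.case by blast+
    have "(\<lambda>m\<in>D. j (\<tau> (\<alpha> m))) = i" "(\<lambda>m\<in>D. j (\<tau> (inv \<tau> m))) = j"
      using S(3) PiE_arb[OF S(1)] PiE_arb[OF S(2)] by (auto simp: restrict_def inv)
    thus ?thesis by (simp add: ij im cong: restrict_cong)
  qed
  show "(\<lambda>(i, j). \<lambda>m\<in>D. j (\<tau> m)) ((\<lambda>h. (\<lambda>m\<in>D. h (\<alpha> m), \<lambda>m\<in>D. h (inv \<tau> m))) h) = h"
    if "h \<in> ?T" for h
  proof -
    have "h \<in> D \<rightarrow>\<^sub>E R" using that by simp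
    thus ?thesis using PiE_arb[of h D "\<lambda>_. R"] by (auto simp: restrict_def im inv)
  qed
qed

section \<open>Sums of Kronecker deltas as counts of index functions\<close>

lemma prod_kron:
  "finite I \<Longrightarrow> (\<Prod>m\<in>I. kron (f m) (g m)) = of_bool (\<forall>m\<in>I. f m = g m)"
  by (induction rule: finite_induct) (auto simp: kron_def)

lemma finite_colourings: "finite (colourings n N)"
  by (simp add: colourings_def finite_PiE)

text \<open>The products of deltas form the indicator of the linked pairs, so the sum is a number of
  pairs, found by \<open>card_linked_functions\<close>.\<close>

lemma sum_kron_linked:
  assumes "\<alpha> \<in> Sym n" "\<beta> \<in> Sym n" "\<sigma> \<in> Sym n" "\<tau> \<in> Sym n"
  shows "(\<Sum>i\<in>colourings n N. \<Sum>j\<in>colourings n N.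
            (\<Prod>m=1..n. kron (i m) (j (\<tau> (\<alpha> m)))) * (\<Prod>m=1..n. kron (j m) (i (\<sigma> (\<beta> m))))) =
         of_nat (card (invariant_colourings n N (\<alpha> \<circ> \<sigma> \<circ> \<beta> \<circ> \<tau>)))"
proof -
  let ?C = "colourings n N"
  let ?S = "{(i, j). i \<in> ?C \<and> j \<in> ?C \<and>
            (\<forall>m\<in>{1..n}. i m = j (\<tau> (\<alpha> m))) \<and> (\<forall>m\<in>{1..n}. j m = i (\<sigma> (\<beta> m)))}"
  have "(\<Sum>i\<in>?C. \<Sum>j\<in>?C. (\<Prod>m=1..n. kron (i m) (j (\<tau> (\<alpha> m)))) * (\<Prod>m=1..n. kron (j m) (i (\<sigma> (\<beta> m))))) =
     (\<Sum>x\<in>?C \<times> ?C. of_bool (x \<in> ?S))"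
    unfolding sum.cartesian_product by (intro sum.cong) (auto simp: prod_kron simp flip: of_bool_conj)
  also have "\<dots> = of_nat (card ((?C \<times> ?C) \<inter> ?S))"
    using finite_colourings by (simp add: sum_of_bool_eq Int_def)
  also have "(?C \<times> ?C) \<inter> ?S = ?S" by auto
  also have "card ?S = card (invariant_colourings n N (\<alpha> \<circ> \<sigma> \<circ> \<beta> \<circ> \<tau>))"
    unfolding invariant_colourings_def colourings_def comp_apply
    using assms by (intro card_linked_functions) (simp_all add: Sym_def)
  finally show ?thesis .
qed

section \<open>Multiplication by Omega\<close>

lemma perm_elem_mult: "perm_elem \<alpha> \<star> perm_elem \<beta> = perm_elem (\<alpha> \<circ> \<beta>)"
  by (simp add: perm_elem_def alg_mult_def)

lemma delta_eq_lookup_id: "delta f = Poly_Mapping.lookup f id"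
  by (simp add: delta_def in_keys_iff if_distrib[of "\<lambda>x. _ * x"] sum.delta cong: if_cong)

text \<open>Left multiplication by \<open>g\<close> moves the coefficient at \<open>inv g\<close> to
  the identity, since \<open>g \<circ> \<beta> = id\<close> only for
  \<open>\<beta> = inv g\<close>.\<close>

lemma delta_perm_elem_mult:
  assumes "bij g"
  shows "delta (perm_elem g \<star> f) = Poly_Mapping.lookup f (inv g)"
proof -
  have "g \<circ> \<beta> = id \<longleftrightarrow> \<beta> = inv g" for \<beta>
    using assms by (metis bij_is_inj bij_is_surj comp_assoc id_comp comp_id inj_iff surj_iff)
  hence "delta (perm_elem g \<star> f) = (\<Sum>\<beta>\<in>Poly_Mapping.keys f. if \<beta> = inv g then Poly_Mapping.lookup f \<beta> else 0)"
    by (simp add: delta_eq_lookup_id perm_elem_def alg_mult_def lookup_sum lookup_single when_def)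
  thus ?thesis by (simp add: in_keys_iff)
qed

lemma lookup_Omega:
  assumes "\<pi> \<in> Sym n"
  shows "Poly_Mapping.lookup (Omega n N) \<pi> = of_nat N powi (int (num_cycles n \<pi>) - int n)"
  using assms by (simp add: Omega_def lookup_sum lookup_single when_def finite_Sym)

lemma Sym_comp: "\<alpha> \<in> Sym n \<Longrightarrow> \<beta> \<in> Sym n \<Longrightarrow> \<alpha> \<circ> \<beta> \<in> Sym n"
  by (simp add: Sym_def permutes_compose)

lemma Sym_inv: "\<alpha> \<in> Sym n \<Longrightarrow> inv \<alpha> \<in> Sym n"
  by (simp add: Sym_def permutes_inv)

lemma power_mult_delta_Omega:
  assumes "\<alpha> \<in> Sym n" "\<sigma> \<in> Sym n" "\<beta> \<in> Sym n" "\<tau> \<in> Sym n" and "N \<ge> 1"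
  shows "of_nat N ^ n * delta (perm_elem \<alpha> \<star> perm_elem \<sigma> \<star> perm_elem \<beta> \<star> perm_elem \<tau> \<star> Omega n N) =
         of_nat (card (invariant_colourings n N (\<alpha> \<circ> \<sigma> \<circ> \<beta> \<circ> \<tau>)))"
proof -
  define g where "g = \<alpha> \<circ> \<sigma> \<circ> \<beta> \<circ> \<tau>"
  have g: "g \<in> Sym n" unfolding g_def using assms by (intro Sym_comp)
  hence "bij g" by (auto simp: Sym_def permutes_bij)
  hence "delta (perm_elem \<alpha> \<star> perm_elem \<sigma> \<star> perm_elem \<beta> \<star> perm_elem \<tau> \<star> Omega n N) =
      of_nat N powi (int (num_cycles n (inv g)) - int n)"
    using Sym_inv[OF g] by (simp add: perm_elem_mult delta_perm_elem_mult lookup_Omega flip: g_def)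
  \<comment> \<open>The factor \<open>N ^ n\<close> cancels the shift by \<open>- n\<close> in the
    exponent. Here \<open>N \<ge> 1\<close> makes the base nonzero, so that the integer power of a
    difference is a quotient.\<close>
  hence "of_nat N ^ n * delta (perm_elem \<alpha> \<star> perm_elem \<sigma> \<star> perm_elem \<beta> \<star> perm_elem \<tau> \<star> Omega n N) =
      of_nat N ^ num_cycles n (inv g)"
    using assms by (simp add: power_int_diff)
  also have "\<dots> = of_nat (card (invariant_colourings n N g))"
    using card_invariant_colourings[OF Sym_inv[OF g], of N] invariant_colourings_inv[OF g, of N] by simp
  finally show ?thesis by (simp add: g_def)
qed

section \<open>The two-point function\<close>

text \<open>Separates the three tensor slots. The projections match the form of the sums over index
  triples in the final computation.\<close>

lemma sum_triple_product:
  fixes f :: "'a \<Rightarrow> 'd :: comm_semiring_0"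
  shows "(\<Sum>x\<in>A \<times> B \<times> C. f (fst x) * g (fst (snd x)) * h (snd (snd x))) = sum f A * sum g B * sum h C"
proof -
  have "(\<Sum>x\<in>A \<times> B \<times> C. f (fst x) * g (fst (snd x)) * h (snd (snd x))) =
      (\<Sum>i\<in>A. \<Sum>j\<in>B. \<Sum>k\<in>C. f i * g j * h k)"
    by (simp add: sum.cartesian_product case_prod_unfold)
  also have "\<dots> = (\<Sum>i\<in>A. f i * (\<Sum>j\<in>B. g j * (\<Sum>k\<in>C. h k)))"
    by (simp add: sum_distrib_left mult.assoc)
  finally show ?thesis by (simp add: mult.assoc flip: sum_distrib_right)
qed

text \<open>Each choice of the three index functions contributes one monomial with coefficient 1,
  the shape that \<open>normal_ordered_two_point_sum_single\<close> evaluates.\<close>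

lemma observable_eq_sum_single:
  "observable n N1 N2 N3 \<sigma>1 \<sigma>2 \<sigma>3 =
     (\<Sum>(i1, i2, i3) \<in> colourings n N1 \<times> colourings n N2 \<times> colourings n N3.
        Poly_Mapping.single
          (image_mset (\<lambda>m. Phi (i1 m) (i2 m) (i3 m)) (mset_set {1..n}) +
           image_mset (\<lambda>m. PhiBar (i1 (\<sigma>1 m)) (i2 (\<sigma>2 m)) (i3 (\<sigma>3 m))) (mset_set {1..n})) 1)"
  unfolding observable_def by (simp add: prod_fvar mult_single colourings_def flip: sum.cartesian_product)

theorem mainTheorem9:
  fixes n N1 N2 N3 :: nat
    and \<sigma>1 \<sigma>2 \<sigma>3 \<tau>1 \<tau>2 \<tau>3 :: "nat \<Rightarrow> nat"
  assumes "n \<ge> 1" and "N1 \<ge> 1" and "N2 \<ge> 1" and "N3 \<ge> 1"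
    and "\<sigma>1 \<in> Sym n" and "\<sigma>2 \<in> Sym n" and "\<sigma>3 \<in> Sym n"
    and "\<tau>1 \<in> Sym n" and "\<tau>2 \<in> Sym n" and "\<tau>3 \<in> Sym n"
  shows "normal_ordered_two_point
           (observable n N1 N2 N3 \<sigma>1 \<sigma>2 \<sigma>3) (observable_bar n N1 N2 N3 \<tau>1 \<tau>2 \<tau>3) =
         (\<Sum>\<mu>1\<in>Sym n. \<Sum>\<mu>2\<in>Sym n.
            of_nat N1 ^ n * of_nat N2 ^ n * of_nat N3 ^ n *
            delta (perm_elem \<mu>1 \<star> perm_elem \<sigma>1 \<star> perm_elem \<mu>2 \<star> perm_elem (inv \<tau>1) \<star> Omega n N1) *
            delta (perm_elem \<mu>1 \<star> perm_elem \<sigma>2 \<star> perm_elem \<mu>2 \<star> perm_elem (inv \<tau>2) \<star> Omega n N2) *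
            delta (perm_elem \<mu>1 \<star> perm_elem \<sigma>3 \<star> perm_elem \<mu>2 \<star> perm_elem (inv \<tau>3) \<star> Omega n N3))"
proof -
  define I where "I = colourings n N1 \<times> colourings n N2 \<times> colourings n N3"
  have finI: "finite I" by (simp add: I_def finite_colourings)
  define S where "S = Sym n \<times> Sym n"
  \<comment> \<open>The deltas of a single tensor slot for the contraction given by
    \<open>\<alpha>\<close> and \<open>\<beta>\<close>. The inverse \<open>inv \<tau>\<close> comes
    from the definition of \<open>observable_bar\<close>.\<close>
  define K where "K \<sigma> \<tau> i j = (\<lambda>(\<alpha>, \<beta>). (\<Prod>m=1..n. kron (i m) (j (inv \<tau> (\<alpha> m)))) *
     (\<Prod>m=1..n. kron (j m) (i (\<sigma> (\<beta> m)))))" for \<sigma> \<tau> i j :: "nat \<Rightarrow> nat"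
  define mon where "mon \<sigma>1 \<sigma>2 \<sigma>3 = (\<lambda>(i1, i2, i3).
     image_mset (\<lambda>m. Phi (i1 m) (i2 m) (i3 m)) (mset_set {1..n}) +
     image_mset (\<lambda>m. PhiBar (i1 (\<sigma>1 m)) (i2 (\<sigma>2 m)) (i3 (\<sigma>3 m))) (mset_set {1..n}))"
    for \<sigma>1 \<sigma>2 \<sigma>3 :: "nat \<Rightarrow> nat"
  have K: "(\<Sum>i\<in>colourings n N. \<Sum>j\<in>colourings n N. K \<sigma> \<tau> i j (\<alpha>, \<beta>)) =
      of_nat (card (invariant_colourings n N (\<alpha> \<circ> \<sigma> \<circ> \<beta> \<circ> inv \<tau>)))"
    if "\<alpha> \<in> Sym n" "\<beta> \<in> Sym n" "\<sigma> \<in> Sym n" "\<tau> \<in> Sym n" for N \<sigma> \<tau> \<alpha> \<beta>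
    unfolding K_def prod.case using that by (intro sum_kron_linked Sym_inv)
  have W: "(\<Sum>M\<in>normal_ordered_contractions (mon \<sigma>1 \<sigma>2 \<sigma>3 i) (mon (inv \<tau>1) (inv \<tau>2) (inv \<tau>3) j). contraction_value M) =
     (\<Sum>s\<in>S. K \<sigma>1 \<tau>1 (fst i) (fst j) s * K \<sigma>2 \<tau>2 (fst (snd i)) (fst (snd j)) s *
        K \<sigma>3 \<tau>3 (snd (snd i)) (snd (snd j)) s)" for i j
  proof -
    obtain i1 i2 i3 j1 j2 j3 where ij: "i = (i1, i2, i3)" "j = (j1, j2, j3)"
      by (metis prod_cases3)
    show ?thesis
      unfolding ij mon_def prod.case
      by (subst sum_normal_ordered_contractions)
         (auto simp: is_Phi_def S_def K_def sum_product prod.distrib sum.cartesian_product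
               intro!: sum.cong)
  qed
  have "normal_ordered_two_point
           (observable n N1 N2 N3 \<sigma>1 \<sigma>2 \<sigma>3) (observable_bar n N1 N2 N3 \<tau>1 \<tau>2 \<tau>3) =
     normal_ordered_two_point (\<Sum>i\<in>I. Poly_Mapping.single (mon \<sigma>1 \<sigma>2 \<sigma>3 i) 1)
       (\<Sum>j\<in>I. Poly_Mapping.single (mon (inv \<tau>1) (inv \<tau>2) (inv \<tau>3) j) 1)"
    unfolding observable_bar_def observable_eq_sum_single mon_def I_def
    by (simp add: case_prod_unfold)
  also have "\<dots> = (\<Sum>i\<in>I. \<Sum>j\<in>I. \<Sum>s\<in>S. K \<sigma>1 \<tau>1 (fst i) (fst j) s *
        K \<sigma>2 \<tau>2 (fst (snd i)) (fst (snd j)) s * K \<sigma>3 \<tau>3 (snd (snd i)) (snd (snd j)) s)"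
    by (simp add: normal_ordered_two_point_sum_single finI W)
  \<comment> \<open>With the contraction \<open>s\<close> fixed outside, the index sums of the three
    slots become independent of each other.\<close>
  also have "\<dots> = (\<Sum>s\<in>S. \<Sum>i\<in>I. \<Sum>j\<in>I. K \<sigma>1 \<tau>1 (fst i) (fst j) s *
        K \<sigma>2 \<tau>2 (fst (snd i)) (fst (snd j)) s * K \<sigma>3 \<tau>3 (snd (snd i)) (snd (snd j)) s)"
    unfolding sum.cartesian_product[where B = I] by (rule trans[OF _ sum.swap])
      (simp add: sum.cartesian_product case_prod_unfold)
  also have "\<dots> = (\<Sum>s\<in>S.
      (\<Sum>i\<in>colourings n N1. \<Sum>j\<in>colourings n N1. K \<sigma>1 \<tau>1 i j s) *
      (\<Sum>i\<in>colourings n N2. \<Sum>j\<in>colourings n N2. K \<sigma>2 \<tau>2 i j s) *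
      (\<Sum>i\<in>colourings n N3. \<Sum>j\<in>colourings n N3. K \<sigma>3 \<tau>3 i j s))"
  proof (rule sum.cong[OF refl])
    fix s
    have inner: "(\<Sum>j\<in>I. K \<sigma>1 \<tau>1 (fst i) (fst j) s *
        K \<sigma>2 \<tau>2 (fst (snd i)) (fst (snd j)) s * K \<sigma>3 \<tau>3 (snd (snd i)) (snd (snd j)) s) =
      (\<Sum>j\<in>colourings n N1. K \<sigma>1 \<tau>1 (fst i) j s) *
      (\<Sum>j\<in>colourings n N2. K \<sigma>2 \<tau>2 (fst (snd i)) j s) *
      (\<Sum>j\<in>colourings n N3. K \<sigma>3 \<tau>3 (snd (snd i)) j s)" for i
      unfolding I_def by (rule sum_triple_product)
    show "(\<Sum>i\<in>I. \<Sum>j\<in>I. K \<sigma>1 \<tau>1 (fst i) (fst j) s *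
        K \<sigma>2 \<tau>2 (fst (snd i)) (fst (snd j)) s * K \<sigma>3 \<tau>3 (snd (snd i)) (snd (snd j)) s) =
      (\<Sum>i\<in>colourings n N1. \<Sum>j\<in>colourings n N1. K \<sigma>1 \<tau>1 i j s) *
      (\<Sum>i\<in>colourings n N2. \<Sum>j\<in>colourings n N2. K \<sigma>2 \<tau>2 i j s) *
      (\<Sum>i\<in>colourings n N3. \<Sum>j\<in>colourings n N3. K \<sigma>3 \<tau>3 i j s)"
      unfolding inner unfolding I_def by (rule sum_triple_product)
  qed
  also have "\<dots> = (\<Sum>(\<alpha>, \<beta>)\<in>S.
      of_nat (card (invariant_colourings n N1 (\<alpha> \<circ> \<sigma>1 \<circ> \<beta> \<circ> inv \<tau>1))) *
      of_nat (card (invariant_colourings n N2 (\<alpha> \<circ> \<sigma>2 \<circ> \<beta> \<circ> inv \<tau>2))) *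
      of_nat (card (invariant_colourings n N3 (\<alpha> \<circ> \<sigma>3 \<circ> \<beta> \<circ> inv \<tau>3))))"
    by (rule sum.cong[OF refl]) (use assms in \<open>auto simp: S_def K\<close>)
  \<comment> \<open>The permutations \<open>\<alpha>\<close> and \<open>\<beta>\<close> become
    \<open>\<mu>1\<close> and \<open>\<mu>2\<close>, and each count is rewritten by
    \<open>power_mult_delta_Omega\<close>, read from right to left.\<close>
  also have "\<dots> = (\<Sum>\<mu>1\<in>Sym n. \<Sum>\<mu>2\<in>Sym n.
            of_nat N1 ^ n * of_nat N2 ^ n * of_nat N3 ^ n *
            delta (perm_elem \<mu>1 \<star> perm_elem \<sigma>1 \<star> perm_elem \<mu>2 \<star> perm_elem (inv \<tau>1) \<star> Omega n N1) *
            delta (perm_elem \<mu>1 \<star> perm_elem \<sigma>2 \<star> perm_elem \<mu>2 \<star> perm_elem (inv \<tau>2) \<star> Omega n N2) *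
            delta (perm_elem \<mu>1 \<star> perm_elem \<sigma>3 \<star> perm_elem \<mu>2 \<star> perm_elem (inv \<tau>3) \<star> Omega n N3))"
    unfolding S_def sum.cartesian_product[symmetric]
    using assms by (intro sum.cong refl) (simp add: Sym_inv mult_ac flip: power_mult_delta_Omega)
  finally show ?thesis .
qed

end
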